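(* Let $G$ be a finite group and $p$ be the smallest prime dividing $|G|$. If $H$ and $K$ are any two subgroups of $G$, then $$\Pr(H,K)\ \ge\ \frac{|C_H(K)|}{|H|}+\frac{p\,(|H|-|X_H|-|C_H(K)|)+|X_H|}{|H||K|}$$ and $$\Pr(H,K)\ \le\ \frac{(p-1)|C_H(K)|+|H|}{p|H|}-\frac{|X_H|(|K|-p)}{p|H||K|},$$ where $X_H=\{x\in H: C_K(x)=1\}$. Moreover, in each of these bounds, $H$ and $K$ can be interchanged.
   Context: $\Pr(H,K)=|\{(x,y)\in H\times K:xy=yx\}|/(|H||K|)$. $C_H(K)=\{h\in H:hk=kh\text{ for all }k\in K\}$; $C_K(x)=\{y\in K:xy=yx\}$, and $C_K(x)=1$ means it is the trivial subgroup. When $H$ and $K$ are interchanged, $X_H$ is replaced by $X_K=\{x\in K:C_H(x)=1\}$ and $C_H(K)$ by $C_K(H)$. *)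

theory Defs
  imports Complex_Main "HOL-Computational_Algebra.Primes" "HOL-Algebra.Coset"
begin

definition comm_prob :: "('a, 'b) monoid_scheme \<Rightarrow> 'a set \<Rightarrow> 'a set \<Rightarrow> real" where
  "comm_prob G H K =
     real (card {(x, y). x \<in> H \<and> y \<in> K \<and> x \<otimes>\<^bsub>G\<^esub> y = y \<otimes>\<^bsub>G\<^esub> x}) / (real (card H) * real (card K))"

definition set_centralizer :: "('a, 'b) monoid_scheme \<Rightarrow> 'a set \<Rightarrow> 'a set \<Rightarrow> 'a set" where
  "set_centralizer G H K = {h \<in> H. \<forall>k\<in>K. h \<otimes>\<^bsub>G\<^esub> k = k \<otimes>\<^bsub>G\<^esub> h}"

definition elem_centralizer :: "('a, 'b) monoid_scheme \<Rightarrow> 'a set \<Rightarrow> 'a \<Rightarrow> 'a set" where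
  "elem_centralizer G K x = {y \<in> K. x \<otimes>\<^bsub>G\<^esub> y = y \<otimes>\<^bsub>G\<^esub> x}"

(* The set written X_H in the bounds; the second subgroup K, left implicit there, is an argument. *)
definition trivial_centralizer_set :: "('a, 'b) monoid_scheme \<Rightarrow> 'a set \<Rightarrow> 'a set \<Rightarrow> 'a set" where
  "trivial_centralizer_set G H K = {x \<in> H. elem_centralizer G K x = {\<one>\<^bsub>G\<^esub>}}"

(* The counts are taken in the reals: |H| - |X_H| - |C_H(K)| is negative when K is trivial,
   so natural-number subtraction would change the first bound. *)
definition comm_lower_bound :: "('a, 'b) monoid_scheme \<Rightarrow> nat \<Rightarrow> 'a set \<Rightarrow> 'a set \<Rightarrow> real" where
  "comm_lower_bound G p H K =
     (let h = real (card H); k = real (card K);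
          c = real (card (set_centralizer G H K)); x = real (card (trivial_centralizer_set G H K))
      in c / h + (real p * (h - x - c) + x) / (h * k))"

definition comm_upper_bound :: "('a, 'b) monoid_scheme \<Rightarrow> nat \<Rightarrow> 'a set \<Rightarrow> 'a set \<Rightarrow> real" where
  "comm_upper_bound G p H K =
     (let h = real (card H); k = real (card K);
          c = real (card (set_centralizer G H K)); x = real (card (trivial_centralizer_set G H K))
      in ((real p - 1) * c + h) / (real p * h) - x * (k - real p) / (real p * h * k))"

end

theory Submission
  imports Defs "HOL-Library.Indicator_Function"
begin

text \<open>Counting commuting pairs by their first entry gives
  \<open>|H| |K| Pr(H,K) = (\<Sum>x\<in>H. |C\<^sub>K(x)|)\<close>, so it suffices to bound each summand.
  Since \<open>C\<^sub>K(x)\<close> is a subgroup of \<open>K\<close>, its order divides \<open>|K|\<close>. It is \<open>|K|\<close> exactly when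
  \<open>x \<in> C\<^sub>H(K)\<close> and \<open>1\<close> exactly when \<open>x \<in> X\<^sub>H\<close>; for every other \<open>x\<close> both the order and the index of
  \<open>C\<^sub>K(x)\<close> in \<open>K\<close> are divisors of \<open>|G|\<close> greater than \<open>1\<close>, hence at least \<open>p\<close>, and so
  \<open>p \<le> |C\<^sub>K(x)| \<le> |K| / p\<close>. Written with indicator functions of \<open>C\<^sub>H(K)\<close> and \<open>X\<^sub>H\<close>, these estimates
  also hold when \<open>K\<close> is trivial, the one case in which the two sets overlap
  (\<open>elem_centralizer_card_bounds\<close>). Summing over \<open>H\<close> gives both bounds
  (\<open>comm_prob_bounds\<close>), and \<open>Pr(H,K) = Pr(K,H)\<close> gives the interchanged ones.\<close>

lemma smallest_prime_le_divisor:
  fixes p d n :: nat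
  assumes "\<And>q. prime q \<Longrightarrow> q dvd n \<Longrightarrow> p \<le> q" and "d dvd n" and "d \<noteq> 1" and "d > 0"
  shows "p \<le> d"
proof -
  obtain q where "prime q" "q dvd d"
    using prime_factor_nat[OF \<open>d \<noteq> 1\<close>] by blast
  then have "p \<le> q"
    using assms(1) dvd_trans[OF _ assms(2)] by blast
  also have "q \<le> d"
    using \<open>q dvd d\<close> \<open>d > 0\<close> by (rule dvd_imp_le)
  finally show ?thesis .
qed

lemma (in group) subgroup_elem_centralizer:
  assumes "subgroup K G" and "x \<in> carrier G"
  shows "subgroup (elem_centralizer G K x) (G\<lparr>carrier := K\<rparr>)"
proof -
  interpret K: subgroup K G by fact
  have "subgroup (elem_centralizer G K x) G"
  proof (rule subgroupI)
    show "elem_centralizer G K x \<subseteq> carrier G"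
      using K.mem_carrier by (auto simp: elem_centralizer_def)
    show "elem_centralizer G K x \<noteq> {}"
      using assms(2) K.one_closed by (auto simp: elem_centralizer_def intro!: exI[of _ \<one>])
  next
    fix a assume "a \<in> elem_centralizer G K x"
    then have a: "a \<in> K" "x \<otimes> a = a \<otimes> x" by (auto simp: elem_centralizer_def)
    have aG: "a \<in> carrier G" using a by simp
    have "inv a \<otimes> x = inv a \<otimes> (x \<otimes> a) \<otimes> inv a"
      using aG assms(2) by (simp add: m_assoc)
    also have "\<dots> = inv a \<otimes> (a \<otimes> x) \<otimes> inv a"
      by (simp only: a(2))
    also have "\<dots> = x \<otimes> inv a"
      using aG assms(2) by (simp flip: m_assoc)
    finally have "x \<otimes> inv a = inv a \<otimes> x" by (rule sym)
    then show "inv a \<in> elem_centralizer G K x"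
      using a by (simp add: elem_centralizer_def)
  next
    fix a b assume "a \<in> elem_centralizer G K x" "b \<in> elem_centralizer G K x"
    then have *: "a \<in> K" "x \<otimes> a = a \<otimes> x" "b \<in> K" "x \<otimes> b = b \<otimes> x"
      by (auto simp: elem_centralizer_def)
    then have G: "a \<in> carrier G" "b \<in> carrier G" by simp_all
    have "x \<otimes> (a \<otimes> b) = a \<otimes> x \<otimes> b"
      using G assms(2) *(2) by (simp flip: m_assoc)
    also have "\<dots> = a \<otimes> b \<otimes> x"
      using G assms(2) *(4) by (simp add: m_assoc)
    finally show "a \<otimes> b \<in> elem_centralizer G K x"
      using * by (simp add: elem_centralizer_def)
  qed
  then show ?thesis
    using assms(1) by (rule subgroup_incl) (auto simp: elem_centralizer_def)
qed

lemma (in group) card_elem_centralizer_dvd: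
  assumes "subgroup K G" and "x \<in> carrier G"
  shows "card (elem_centralizer G K x) dvd card K"
proof -
  interpret K: group "G\<lparr>carrier := K\<rparr>"
    using assms(1) by (rule subgroup_imp_group)
  have "card (rcosets\<^bsub>G\<lparr>carrier := K\<rparr>\<^esub> elem_centralizer G K x) * card (elem_centralizer G K x)
      = card K"
    using K.lagrange[OF subgroup_elem_centralizer[OF assms]] by (simp add: order_def)
  then show ?thesis
    by (rule dvdI[OF sym, OF trans[OF mult.commute]])
qed

text \<open>For nontrivial \<open>K\<close> at most one of the two indicators is nonzero. If \<open>K\<close> is trivial then both
  are \<open>1\<close> for every \<open>x \<in> H\<close>, and the bounds read \<open>2 - p \<le> 1\<close> and \<open>1 \<le> 2 - 1/p\<close>.\<close>

lemma (in group) elem_centralizer_card_bounds: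
  fixes p :: nat
  assumes fin: "finite (carrier G)" and p: "prime p"
    and least: "\<And>q :: nat. prime q \<Longrightarrow> q dvd order G \<Longrightarrow> p \<le> q"
    and H: "subgroup H G" and K: "subgroup K G" and x: "x \<in> H"
  defines "n \<equiv> real (card (elem_centralizer G K x))" and "k \<equiv> real (card K)"
    and "c \<equiv> indicat_real (set_centralizer G H K) x"
    and "t \<equiv> indicat_real (trivial_centralizer_set G H K) x"
  shows "k * c + real p * (1 - t - c) + t \<le> n"
    and "n \<le> k / real p + (k - k / real p) * c - (k / real p - 1) * t"
proof -
  let ?C = "elem_centralizer G K x"
  interpret K: subgroup K G by fact
  have xG: "x \<in> carrier G" using H x by (simp add: subgroup.mem_carrier)
  have p2: "p \<ge> 2" using p by (rule prime_ge_2_nat)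
  have finK: "finite K" using fin K.subset finite_subset by blast
  have kG: "card K dvd order G"
    unfolding lagrange[OF K, symmetric] by simp
  have CK: "?C \<subseteq> K" by (auto simp: elem_centralizer_def)
  have one: "\<one> \<in> ?C" using xG by (simp add: elem_centralizer_def)
  have finC: "finite ?C" using CK finK by (rule finite_subset)
  have Cpos: "card ?C > 0" using one finC by (auto simp: card_gt_0_iff)
  obtain m where m: "card K = card ?C * m"
    using card_elem_centralizer_dvd[OF K xG] by (rule dvdE)
  have Kpos: "card K > 0" using finK K.one_closed card_gt_0_iff by blast
  then have mpos: "m > 0" using m by (cases m) auto
  have c_iff: "x \<in> set_centralizer G H K \<longleftrightarrow> ?C = K"
    using x by (auto simp: set_centralizer_def elem_centralizer_def)
  have t_iff: "x \<in> trivial_centralizer_set G H K \<longleftrightarrow> ?C = {\<one>}"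
    using x by (simp add: trivial_centralizer_set_def)
  have n_ge: "p \<le> card ?C" if "?C \<noteq> {\<one>}"
  proof (rule smallest_prime_le_divisor[OF least])
    show "card ?C dvd order G" by (rule dvd_mult_left[OF kG[unfolded m]])
    show "card ?C \<noteq> 1" using that one by (auto simp: card_1_singleton_iff)
  qed (use Cpos in auto)
  have m_ge: "p \<le> m" if "?C \<noteq> K"
  proof (rule smallest_prime_le_divisor[OF least])
    show "m dvd order G" by (rule dvd_mult_right[OF kG[unfolded m]])
    show "m \<noteq> 1" using that CK finK m by (auto dest: card_subset_eq)
  qed (use mpos in auto)
  have n_le: "n \<le> k / real p" if "?C \<noteq> K"
  proof -
    have "card ?C * p \<le> card K" using m m_ge[OF that] by simp
    then have "n * real p \<le> k" unfolding n_def k_def by (simp flip: of_nat_mult)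
    then show ?thesis using p2 by (simp add: field_simps)
  qed
  show "k * c + real p * (1 - t - c) + t \<le> n"
    using p2 n_ge c_iff t_iff
    by (cases "?C = K"; cases "?C = {\<one>}") (auto simp: n_def k_def c_def t_def)
  show "n \<le> k / real p + (k - k / real p) * c - (k / real p - 1) * t"
    using p2 n_le c_iff t_iff
    by (cases "?C = K"; cases "?C = {\<one>}") (auto simp: n_def k_def c_def t_def)
qed

lemma comm_prob_eq_sum:
  assumes "finite H" and "finite K"
  shows "comm_prob G H K =
    (\<Sum>x\<in>H. real (card (elem_centralizer G K x))) / (real (card H) * real (card K))"
proof -
  have "{(x, y). x \<in> H \<and> y \<in> K \<and> x \<otimes>\<^bsub>G\<^esub> y = y \<otimes>\<^bsub>G\<^esub> x} = Sigma H (elem_centralizer G K)"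
    by (auto simp: elem_centralizer_def)
  moreover have "\<forall>x\<in>H. finite (elem_centralizer G K x)"
    using assms(2) by (simp add: elem_centralizer_def)
  ultimately show ?thesis
    using assms(1) by (simp add: comm_prob_def card_SigmaI)
qed

lemma comm_prob_commute: "comm_prob G H K = comm_prob G K H"
proof -
  have "bij_betw prod.swap {(x, y). x \<in> H \<and> y \<in> K \<and> x \<otimes>\<^bsub>G\<^esub> y = y \<otimes>\<^bsub>G\<^esub> x}
          {(x, y). x \<in> K \<and> y \<in> H \<and> x \<otimes>\<^bsub>G\<^esub> y = y \<otimes>\<^bsub>G\<^esub> x}"
    by (rule bij_betwI[where g = prod.swap]) auto
  then show ?thesis
    by (simp add: comm_prob_def bij_betw_same_card mult.commute)
qed

lemma comm_prob_bounds:
  fixes G :: "('a, 'b) monoid_scheme" and p :: nat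
  assumes G: "group G" and fin: "finite (carrier G)" and p: "prime p"
    and least: "\<And>q :: nat. prime q \<Longrightarrow> q dvd order G \<Longrightarrow> p \<le> q"
    and H: "subgroup H G" and K: "subgroup K G"
  shows "comm_lower_bound G p H K \<le> comm_prob G H K"
    and "comm_prob G H K \<le> comm_upper_bound G p H K"
proof -
  interpret group G by fact
  define h k where "h = real (card H)" and "k = real (card K)"
  define c where "c = real (card (set_centralizer G H K))"
  define t where "t = real (card (trivial_centralizer_set G H K))"
  define S where "S = (\<Sum>x\<in>H. real (card (elem_centralizer G K x)))"
  let ?c = "indicat_real (set_centralizer G H K)"
  let ?t = "indicat_real (trivial_centralizer_set G H K)"
  have finHK: "finite H" "finite K"
    using fin subgroup.subset[OF H] subgroup.subset[OF K] by (auto intro: finite_subset)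
  have pos: "h > 0" "k > 0"
    using finHK subgroup.one_closed[OF H] subgroup.one_closed[OF K]
    by (auto simp: h_def k_def card_gt_0_iff)
  have ppos: "real p > 0" using p by (simp add: prime_gt_0_nat)
  have "(\<Sum>x\<in>H. indicat_real A x) = real (card A)" if "A \<subseteq> H" for A
    using sum.inter_restrict[OF finHK(1), of "\<lambda>_. 1 :: real" A] that
    by (simp add: indicator_def Int_absorb1 of_bool_def)
  then have sums: "(\<Sum>x\<in>H. ?c x) = c" "(\<Sum>x\<in>H. ?t x) = t"
    by (auto simp: c_def t_def set_centralizer_def trivial_centralizer_set_def)
  have Pr: "comm_prob G H K = S / (h * k)"
    using comm_prob_eq_sum[OF finHK] by (simp add: S_def h_def k_def)
  have "(\<Sum>x\<in>H. k * ?c x + real p * (1 - ?t x - ?c x) + ?t x) \<le> S"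
    unfolding S_def k_def
    by (intro sum_mono elem_centralizer_card_bounds(1)[OF fin p least H K])
  then have "k * c + real p * (h - t - c) + t \<le> S"
    by (simp add: sum.distrib sum_subtractf sums flip: sum_distrib_left h_def)
  then have "(k * c + real p * (h - t - c) + t) / (h * k) \<le> S / (h * k)"
    using pos by (intro divide_right_mono) auto
  moreover have "comm_lower_bound G p H K = (k * c + real p * (h - t - c) + t) / (h * k)"
    using pos by (simp add: comm_lower_bound_def Let_def field_simps flip: h_def k_def c_def t_def)
  ultimately show "comm_lower_bound G p H K \<le> comm_prob G H K"
    by (simp add: Pr)
  have "S \<le> (\<Sum>x\<in>H. k / real p + (k - k / real p) * ?c x - (k / real p - 1) * ?t x)"
    unfolding S_def k_def
    by (intro sum_mono elem_centralizer_card_bounds(2)[OF fin p least H K])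
  then have "S \<le> h * (k / real p) + (k - k / real p) * c - (k / real p - 1) * t"
    by (simp add: sum.distrib sum_subtractf sums flip: sum_distrib_left h_def)
  then have "S / (h * k) \<le> (h * (k / real p) + (k - k / real p) * c - (k / real p - 1) * t) / (h * k)"
    using pos by (intro divide_right_mono) auto
  moreover have "comm_upper_bound G p H K
      = (h * (k / real p) + (k - k / real p) * c - (k / real p - 1) * t) / (h * k)"
    using pos ppos
    by (simp add: comm_upper_bound_def Let_def field_simps flip: h_def k_def c_def t_def)
  ultimately show "comm_prob G H K \<le> comm_upper_bound G p H K"
    by (simp add: Pr)
qed

theorem theorem5p2p8:
  fixes G :: "('a, 'b) monoid_scheme" and H K :: "'a set" and p :: nat
  assumes "group G" and "finite (carrier G)"
    and "prime p" and "p dvd order G" and "\<And>q :: nat. prime q \<Longrightarrow> q dvd order G \<Longrightarrow> p \<le> q"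
    and "subgroup H G" and "subgroup K G"
  shows "comm_prob G H K \<ge> comm_lower_bound G p H K
       \<and> comm_prob G H K \<le> comm_upper_bound G p H K
       \<and> comm_prob G H K \<ge> comm_lower_bound G p K H
       \<and> comm_prob G H K \<le> comm_upper_bound G p K H"
  using comm_prob_bounds[OF assms(1-3,5-7)] comm_prob_bounds[OF assms(1-3,5,7,6)]
  by (simp add: comm_prob_commute[of G K H])

end
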